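(* Let $(X,d)$ be a locally compact metric space. Suppose that one of the following holds: (1) $\mathcal{M}\subseteq\mathbf{TM}(X)$ is a family which is uniformly bounded in variation; (2) for a given $M>0$, $\mathcal{M}\subseteq\mathbf{DTM}(X)$ is the family of deficient topological measures corresponding to functionals $\mathcal{R}$ on $C_c^+(X)$ with $\|\mathcal{R}\|\le M$. If $(\mu_\alpha)$ is a net in $\mathcal{M}$, $\mu\in\mathcal{M}$, and $d_{\mathrm{KR}}(\mu_\alpha,\mu)\to 0$, then $\mu_\alpha$ converges weakly to $\mu$.
   Context: $\mathcal{O}(X)$, $\mathcal{C}(X)$, $\mathcal{K}(X)$ are the collections of open, closed, compact subsets of $X$. A deficient topological measure on $X$ is a set function $\nu:\mathcal{C}(X)\cup\mathcal{O}(X)\to[0,\infty]$, not identically $\infty$, such that: (DTM1) $\nu(C\sqcup K)=\nu(C)+\nu(K)$ for disjoint $C,K\in\mathcal{K}(X)$; (DTM2) $\nu(U)=\sup\{\nu(C): C\subseteq U,\ C\in\mathcal{K}(X)\}$ for $U\in\mathcal{O}(X)$; (DTM3) $\nu(F)=\inf\{\nu(U): F\subseteq U,\ U\in\mathcal{O}(X)\}$ for $F\in\mathcal{C}(X)$. A topological measure is a set function $\mu:\mathcal{C}(X)\cup\mathcal{O}(X)\to[0,\infty]$, not identically $\infty$, satisfying (DTM2), (DTM3) and: if $A,B,A\sqcup B\in\mathcal{K}(X)\cup\mathcal{O}(X)$ (disjoint union) then $\mu(A\sqcup B)=\mu(A)+\mu(B)$. $\mathbf{DTM}(X)$ and $\mathbf{TM}(X)$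 are the sets of finite ($\mu(X)<\infty$) deficient topological measures and finite topological measures. A family is uniformly bounded in variation if there is a constant $c>0$ with $\|\mu\|=\mu(X)\le c$ for all its members. $C_0^+(X)$ (resp. $C_c(X)$, $C_c^+(X)$) is the set of nonnegative continuous functions vanishing at infinity (resp. continuous functions with compact support, nonnegative continuous functions with compact support); $\|f\|$ is the uniform norm. For $\mu\in\mathbf{DTM}(X)$ and bounded continuous $f:X\to\mathbb{R}$ with $f(X)\subseteq[a,b]$, the quasi-integral is $\int_X f\,d\mu=\mathcal{R}_\mu(f)=\int_a^b\mu(f^{-1}((t,\infty)))\,dt+a\mu(X)$ (independent of the choice of $[a,b]$). In (2), the functional corresponding to $\mu$ is $\mathcal{R}=\mathcal{R}_\mu$ restricted to $C_c^+(X)$, with $\|\mathcal{R}\|=\sup\{|\mathcal{R}(f)|: f\in C_c^+(X),\ \|f\|\le1\}$; conversely $\mu$ is recovered from $\mathcal{R}$ by $\mu(U)=\sup\{\mathcal{R}(f): f\in C_c(X),\ 0\le f\le 1,\ \mathrm{supp} f\subseteq U\}$ for open $U$ and by (DTM3) for closed sets. The Kantorovich-Rubinstein metric is $$d_{\mathrm{KR}}(\mu,\nu)=\sup\Big\{\Big|\int_X f\,d\mu-\int_X f\,d\nu\Big|:\ f\in Lip_1(X,d)\cap C_c(X),\ \|f\|\le1\Big\},$$ where $Lip_1(X,d)=\{f:X\to\mathbb{R}:\ |f(x)-f(y)|\le d(x,y)\ \forall x,y\in X\}$. A net $\mu_\alpha$ in $\mathbf{DTM}(X)$ converges weakly to $\mu\in\mathbf{DTM}(X)$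 if $\int_X f\,d\mu_\alpha\to\int_X f\,d\mu$ for every $f\in C_0^+(X)$. *)

theory Defs
  imports "HOL-Analysis.Analysis"
begin

section \<open>Deficient topological measures\<close>

text \<open>
  A set function on the open and closed sets is represented by a total function
  \<open>'a set \<Rightarrow> ennreal\<close>. Its values on other sets are unconstrained and are
  never used.
\<close>

definition not_identically_infinite :: "('a::t2_space set \<Rightarrow> ennreal) \<Rightarrow> bool" where
  "not_identically_infinite \<nu> \<longleftrightarrow> (\<exists>A. (open A \<or> closed A) \<and> \<nu> A \<noteq> \<infinity>)"

definition inner_compact_regular :: "('a::t2_space set \<Rightarrow> ennreal) \<Rightarrow> bool" where
  "inner_compact_regular \<nu> \<longleftrightarrow>
     (\<forall>U. open U \<longrightarrow> \<nu> U = (SUP C\<in>{C. compact C \<and> C \<subseteq> U}. \<nu> C))"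

definition outer_open_regular :: "('a::t2_space set \<Rightarrow> ennreal) \<Rightarrow> bool" where
  "outer_open_regular \<nu> \<longleftrightarrow>
     (\<forall>F. closed F \<longrightarrow> \<nu> F = (INF U\<in>{U. open U \<and> F \<subseteq> U}. \<nu> U))"

definition deficient_topological_measure :: "('a::t2_space set \<Rightarrow> ennreal) \<Rightarrow> bool" where
  "deficient_topological_measure \<nu> \<longleftrightarrow>
     not_identically_infinite \<nu> \<and>
     (\<forall>C K. compact C \<and> compact K \<and> C \<inter> K = {} \<longrightarrow> \<nu> (C \<union> K) = \<nu> C + \<nu> K) \<and>
     inner_compact_regular \<nu> \<and> outer_open_regular \<nu>"

definition topological_measure :: "('a::t2_space set \<Rightarrow> ennreal) \<Rightarrow> bool" where
  "topological_measure \<mu> \<longleftrightarrow>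
     not_identically_infinite \<mu> \<and>
     (\<forall>A B. (compact A \<or> open A) \<and> (compact B \<or> open B) \<and> (compact (A \<union> B) \<or> open (A \<union> B)) \<and>
        A \<inter> B = {} \<longrightarrow> \<mu> (A \<union> B) = \<mu> A + \<mu> B) \<and>
     inner_compact_regular \<mu> \<and> outer_open_regular \<mu>"

definition DTM :: "('a::t2_space set \<Rightarrow> ennreal) set" where
  "DTM = {\<mu>. deficient_topological_measure \<mu> \<and> \<mu> UNIV < \<infinity>}"

definition TM :: "('a::t2_space set \<Rightarrow> ennreal) set" where
  "TM = {\<mu>. topological_measure \<mu> \<and> \<mu> UNIV < \<infinity>}"

definition uniformly_bounded_variation :: "('a::t2_space set \<Rightarrow> ennreal) set \<Rightarrow> bool" where
  "uniformly_bounded_variation \<M> \<longleftrightarrow> (\<exists>c::real. c > 0 \<and> (\<forall>\<mu>\<in>\<M>. \<mu> UNIV \<le> ennreal c))"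


section \<open>Function spaces\<close>

definition C0_plus :: "('a::t2_space \<Rightarrow> real) set" where
  "C0_plus = {f. continuous_on UNIV f \<and> (\<forall>x. 0 \<le> f x) \<and>
                 (\<forall>\<epsilon>>0. \<exists>K. compact K \<and> (\<forall>x. x \<notin> K \<longrightarrow> \<bar>f x\<bar> < \<epsilon>))}"

definition Cc :: "('a::t2_space \<Rightarrow> real) set" where
  "Cc = {f. continuous_on UNIV f \<and> compact (closure {x. f x \<noteq> 0})}"

definition Cc_plus :: "('a::t2_space \<Rightarrow> real) set" where
  "Cc_plus = {f \<in> Cc. \<forall>x. 0 \<le> f x}"

text \<open>The real supremum is meaningful only for bounded \<open>f\<close>.\<close>

definition unorm :: "('a \<Rightarrow> real) \<Rightarrow> real" where
  "unorm f = (SUP x. \<bar>f x\<bar>)"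


section \<open>Quasi-integrals\<close>

definition quasi_integral_over ::
  "real \<Rightarrow> real \<Rightarrow> ('a::t2_space set \<Rightarrow> ennreal) \<Rightarrow> ('a \<Rightarrow> real) \<Rightarrow> real" where
  "quasi_integral_over a b \<mu> f =
     integral {a..b} (\<lambda>t. enn2real (\<mu> (f -` {t<..}))) + a * enn2real (\<mu> UNIV)"

text \<open>
  For bounded \<open>f\<close> the interval \<open>[a, b]\<close> is taken to be the smallest one containing
  the range; \<open>quasi_integral_eq\<close> below shows that every other choice gives the same value.
\<close>

definition quasi_integral :: "('a::t2_space set \<Rightarrow> ennreal) \<Rightarrow> ('a \<Rightarrow> real) \<Rightarrow> real" where
  "quasi_integral \<mu> f = quasi_integral_over (Inf (range f)) (Sup (range f)) \<mu> f"

text \<open>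
  The norm of a functional on \<open>Cc_plus\<close>; for \<open>quasi_integral \<mu>\<close> with \<open>\<mu> \<in> DTM\<close> the set
  is bounded by \<open>\<mu> UNIV\<close> (\<open>bdd_above_functional_norm\<close>), so the real supremum is the true one.
\<close>

definition functional_norm :: "(('a::t2_space \<Rightarrow> real) \<Rightarrow> real) \<Rightarrow> real" where
  "functional_norm R = (SUP f\<in>{f \<in> Cc_plus. unorm f \<le> 1}. \<bar>R f\<bar>)"

text \<open>Here, too, the set is bounded for \<open>\<mu>, \<nu> \<in> DTM\<close>, by \<open>\<mu> UNIV + \<nu> UNIV\<close> (\<open>bdd_above_dKR\<close>).\<close>

definition dKR ::
  "('a::metric_space set \<Rightarrow> ennreal) \<Rightarrow> ('a set \<Rightarrow> ennreal) \<Rightarrow> real" where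
  "dKR \<mu> \<nu> = (SUP f\<in>{f \<in> Cc. 1-lipschitz_on UNIV f \<and> unorm f \<le> 1}.
                \<bar>quasi_integral \<mu> f - quasi_integral \<nu> f\<bar>)"

text \<open>Nets are represented, as usual, by a function together with a filter on its index type.\<close>

definition converges_weakly ::
  "('i \<Rightarrow> 'a::t2_space set \<Rightarrow> ennreal) \<Rightarrow> ('a set \<Rightarrow> ennreal) \<Rightarrow> 'i filter \<Rightarrow> bool" where
  "converges_weakly \<mu>s \<mu> F \<longleftrightarrow>
     (\<forall>f\<in>C0_plus. ((\<lambda>i. quasi_integral (\<mu>s i) f) \<longlongrightarrow> quasi_integral \<mu> f) F)"


section \<open>Well-definedness\<close>

lemma TM_subset_DTM: "TM \<subseteq> DTM"
  unfolding TM_def DTM_def topological_measure_def deficient_topological_measure_def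
  by (auto simp: compact_Un)

lemma DTM_mono_open:
  assumes "\<mu> \<in> DTM" "open U" "open V" "U \<subseteq> V"
  shows "\<mu> U \<le> \<mu> V"
proof -
  have "\<mu> U = (SUP C\<in>{C. compact C \<and> C \<subseteq> U}. \<mu> C)" "\<mu> V = (SUP C\<in>{C. compact C \<and> C \<subseteq> V}. \<mu> C)"
    using assms by (auto simp: DTM_def deficient_topological_measure_def inner_compact_regular_def)
  then show ?thesis
    using assms(4) by (auto intro!: SUP_subset_mono)
qed

lemma DTM_empty:
  assumes "\<mu> \<in> DTM"
  shows "\<mu> {} = 0"
proof -
  have "\<forall>C K. compact C \<and> compact K \<and> C \<inter> K = {} \<longrightarrow> \<mu> (C \<union> K) = \<mu> C + \<mu> K"
    using assms by (simp add: DTM_def deficient_topological_measure_def)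
  from this[rule_format, of "{}" "{}"] have "\<mu> {} + 0 = \<mu> {} + \<mu> {}"
    by simp
  moreover have "\<mu> {} < \<infinity>"
    using DTM_mono_open[OF assms, of "{}" UNIV] assms by (auto simp: DTM_def)
  ultimately show ?thesis
    unfolding ennreal_add_left_cancel by (elim disjE) simp_all
qed

context
  fixes \<mu> :: "'a::t2_space set \<Rightarrow> ennreal" and f :: "'a \<Rightarrow> real"
  assumes \<mu>: "\<mu> \<in> DTM" and f: "continuous_on UNIV f"
begin

lemma level_mono: "s \<le> t \<Longrightarrow> enn2real (\<mu> (f -` {t<..})) \<le> enn2real (\<mu> (f -` {s<..}))"
proof -
  assume "s \<le> t"
  have op: "open (f -` {r<..})" for r
    using f by (simp add: continuous_on_open_vimage)
  have "\<mu> (f -` {t<..}) \<le> \<mu> (f -` {s<..})"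
    using \<open>s \<le> t\<close> by (intro DTM_mono_open[OF \<mu> op op]) auto
  moreover have "\<mu> (f -` {s<..}) < top"
    using DTM_mono_open[OF \<mu> op[of s] open_UNIV] \<mu> by (auto simp: DTM_def)
  ultimately show ?thesis by (rule enn2real_mono)
qed

lemma level_le: "enn2real (\<mu> (f -` {t<..})) \<le> enn2real (\<mu> UNIV)"
proof -
  have "open (f -` {t<..})"
    using f by (simp add: continuous_on_open_vimage)
  then have "\<mu> (f -` {t<..}) \<le> \<mu> UNIV"
    by (intro DTM_mono_open[OF \<mu>]) auto
  moreover have "\<mu> UNIV < top" using \<mu> by (auto simp: DTM_def)
  ultimately show ?thesis by (rule enn2real_mono)
qed

lemma level_integrable: "(\<lambda>t. enn2real (\<mu> (f -` {t<..}))) integrable_on {a..b}"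
proof -
  have "(\<lambda>t. - enn2real (\<mu> (f -` {t<..}))) integrable_on {a..b}"
    by (rule integrable_on_mono_on) (auto intro!: mono_onI level_mono)
  then show ?thesis
    using integrable_neg by fastforce
qed

lemma quasi_integral_eq:
  assumes "range f \<subseteq> {a..b}"
  shows "quasi_integral \<mu> f = quasi_integral_over a b \<mu> f"
proof -
  define A B m where "A = Inf (range f)" and "B = Sup (range f)" and "m = enn2real (\<mu> UNIV)"
  let ?g = "\<lambda>t. enn2real (\<mu> (f -` {t<..}))"
  have bd: "bdd_below (range f)" "bdd_above (range f)"
    using assms by (meson bdd_below_mono bdd_below_Icc bdd_above_mono bdd_above_Icc)+
  have AB: "A \<le> f x" "f x \<le> B" for x
    unfolding A_def B_def using bd by (simp_all add: cInf_lower cSup_upper)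
  have ab: "a \<le> A" "A \<le> B" "B \<le> b"
  proof -
    show "a \<le> A" unfolding A_def using assms by (intro cInf_greatest) auto
    show "B \<le> b" unfolding B_def using assms by (intro cSup_least) auto
    show "A \<le> B" using AB[of undefined] by linarith
  qed
  have low: "?g t = m" if "t < A" for t
  proof -
    have "f -` {t<..} = UNIV" using AB(1) that by (auto intro: less_le_trans)
    then show ?thesis by (simp add: m_def)
  qed
  have high: "?g t = 0" if "t \<ge> B" for t
  proof -
    have "f x \<le> t" for x using AB(2)[of x] that by linarith
    then have "f -` {t<..} = {}" by (simp add: vimage_def not_less)
    then show ?thesis using DTM_empty[OF \<mu>] by simp
  qed
  have "(?g has_integral (A - a) * m) {a..A}"
  proof (rule has_integral_spike[of "{A}"])
    show "((\<lambda>t. m) has_integral (A - a) * m) {a..A}"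
      using has_integral_const_real[of m a A] ab by simp
  qed (auto simp: low)
  moreover have "(?g has_integral 0) {B..b}"
    by (rule has_integral_is_0) (auto simp: high)
  moreover have "integral {a..b} ?g = integral {a..A} ?g + integral {A..b} ?g"
    using ab by (intro Henstock_Kurzweil_Integration.integral_combine[symmetric] level_integrable) auto
  moreover have "integral {A..b} ?g = integral {A..B} ?g + integral {B..b} ?g"
    using ab by (intro Henstock_Kurzweil_Integration.integral_combine[symmetric] level_integrable) auto
  ultimately have "integral {a..b} ?g = (A - a) * m + integral {A..B} ?g"
    by (simp add: integral_unique)
  then show ?thesis
    unfolding quasi_integral_def quasi_integral_over_def A_def[symmetric] B_def[symmetric] m_def[symmetric]
    by (simp add: algebra_simps)
qed

lemma abs_quasi_integral_le:
  assumes "\<And>x. \<bar>f x\<bar> \<le> 1"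
  shows "\<bar>quasi_integral \<mu> f\<bar> \<le> enn2real (\<mu> UNIV)"
proof -
  let ?g = "\<lambda>t. enn2real (\<mu> (f -` {t<..}))"
  have "range f \<subseteq> {-1..1}" using assms by (auto simp: abs_le_iff minus_le_iff)
  then have "quasi_integral \<mu> f = integral {-1..1} ?g - enn2real (\<mu> UNIV)"
    by (simp add: quasi_integral_eq quasi_integral_over_def)
  moreover have "0 \<le> integral {-1..1} ?g"
    by (intro Henstock_Kurzweil_Integration.integral_nonneg level_integrable) auto
  moreover have "integral {-1..1} ?g \<le> integral {-1..1::real} (\<lambda>_. enn2real (\<mu> UNIV))"
    by (intro integral_le level_integrable level_le) auto
  ultimately show ?thesis by simp
qed

end

lemma abs_le_unorm_Cc:
  assumes "f \<in> Cc"
  shows "\<bar>f x\<bar> \<le> unorm f"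
proof -
  let ?K = "closure {x. f x \<noteq> 0}"
  have "compact (f ` ?K)"
  proof (rule compact_continuous_image)
    show "continuous_on ?K f" "compact ?K"
      using assms continuous_on_subset[of UNIV f ?K] by (simp_all add: Cc_def)
  qed
  then have "bounded (f ` ?K)" by (rule compact_imp_bounded)
  then obtain B where B: "\<And>x. x \<in> ?K \<Longrightarrow> \<bar>f x\<bar> \<le> B"
    unfolding bounded_real by blast
  have "\<bar>f x\<bar> \<le> max B 0" for x
  proof (cases "f x = 0")
    case False
    then have "x \<in> ?K" using closure_subset[of "{x. f x \<noteq> 0}"] by blast
    then show ?thesis using B by (simp add: le_max_iff_disj)
  next
    case True
    then show ?thesis by simp
  qed
  then have "bdd_above (range (\<lambda>x. \<bar>f x\<bar>))" by (rule bdd_aboveI2)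
  then show ?thesis unfolding unorm_def by (rule cSUP_upper[OF UNIV_I])
qed

lemma bdd_above_functional_norm:
  fixes \<mu> :: "'a::t2_space set \<Rightarrow> ennreal"
  assumes "\<mu> \<in> DTM"
  shows "bdd_above ((\<lambda>f. \<bar>quasi_integral \<mu> f\<bar>) ` {f \<in> Cc_plus. unorm f \<le> 1})"
proof (rule bdd_aboveI2)
  fix f :: "'a \<Rightarrow> real" assume "f \<in> {f \<in> Cc_plus. unorm f \<le> 1}"
  then have f: "f \<in> Cc" "unorm f \<le> 1" by (auto simp: Cc_plus_def)
  show "\<bar>quasi_integral \<mu> f\<bar> \<le> enn2real (\<mu> UNIV)"
  proof (rule abs_quasi_integral_le[OF assms])
    show "continuous_on UNIV f" using f(1) by (simp add: Cc_def)
    show "\<bar>f x\<bar> \<le> 1" for x using abs_le_unorm_Cc[OF f(1), of x] f(2) by linarith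
  qed
qed

lemma bdd_above_dKR:
  fixes \<mu> \<nu> :: "'a::metric_space set \<Rightarrow> ennreal"
  assumes "\<mu> \<in> DTM" "\<nu> \<in> DTM"
  shows "bdd_above ((\<lambda>f. \<bar>quasi_integral \<mu> f - quasi_integral \<nu> f\<bar>) `
           {f \<in> Cc. 1-lipschitz_on UNIV f \<and> unorm f \<le> 1})"
proof (rule bdd_aboveI2)
  fix f :: "'a \<Rightarrow> real" assume "f \<in> {f \<in> Cc. 1-lipschitz_on UNIV f \<and> unorm f \<le> 1}"
  then have f: "f \<in> Cc" "unorm f \<le> 1" by auto
  have "\<bar>quasi_integral \<rho> f\<bar> \<le> enn2real (\<rho> UNIV)" if "\<rho> \<in> DTM" for \<rho>
  proof (rule abs_quasi_integral_le[OF that])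
    show "continuous_on UNIV f" using f(1) by (simp add: Cc_def)
    show "\<bar>f x\<bar> \<le> 1" for x using abs_le_unorm_Cc[OF f(1), of x] f(2) by linarith
  qed
  from this[OF assms(1)] this[OF assms(2)]
  show "\<bar>quasi_integral \<mu> f - quasi_integral \<nu> f\<bar> \<le> enn2real (\<mu> UNIV) + enn2real (\<nu> UNIV)"
    by linarith
qed

end

theory Submission
  imports Defs
begin

text \<open>
  The quasi-integral is not linear, but it is monotone, and replacing \<open>f\<close> by \<open>c * f + d\<close> with
  \<open>c > 0\<close> multiplies it by \<open>c\<close> and adds \<open>d\<close> times the mass of \<open>UNIV\<close>, because the superlevel
  sets of \<open>f\<close> only get reparametrised. These two properties already
  make \<open>f \<mapsto> quasi_integral \<mu> f\<close> Lipschitz in the uniform norm with constant \<open>\<mu> UNIV\<close>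
  (\<open>quasi_integral_uniform_lipschitz\<close>). So along a family with bounded \<open>\<mu> UNIV\<close> it is enough to
  test weak convergence on a uniformly dense set of functions.

  Such a set is formed by the nonnegative Lipschitz functions of compact support
  (\<open>C0_plus_approx_lipschitz\<close>): cut \<open>f\<close> off at a small height to make its support compact, then
  replace the result \<open>h\<close> by the inf-convolution \<open>x \<mapsto> INF y. h y + L * dist x y\<close>, which is
  \<open>L\<close>-Lipschitz, lies between \<open>0\<close> and \<open>h\<close> (so has no larger support), and is uniformly close to \<open>h\<close>
  when \<open>L\<close> is large. Dividing such a function by a large constant makes it admissible in the
  definition of \<open>dKR\<close>, and homogeneity of the quasi-integral returns the factor.

  Both alternatives of the hypothesis give a bound on \<open>\<mu> UNIV\<close>. For families of topological
  measures it is the assumption; for families given by \<open>functional_norm\<close> it is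
  \<open>DTM_UNIV_le_functional_norm\<close>, where local compactness supplies the bump functions that show
  \<open>\<mu> C\<close> to be at most the norm of the functional for every compact \<open>C\<close>.
\<close>

section \<open>Quasi-integrals as functions of the integrand\<close>

lemma quasi_integral_mono:
  fixes f g :: "'a::t2_space \<Rightarrow> real"
  assumes \<mu>: "\<mu> \<in> DTM" and f: "continuous_on UNIV f" and g: "continuous_on UNIV g"
    and ranges: "range f \<subseteq> {a..b}" "range g \<subseteq> {a..b}"
    and le: "\<And>x. f x \<le> g x"
  shows "quasi_integral \<mu> f \<le> quasi_integral \<mu> g"
proof -
  have "enn2real (\<mu> (f -` {t<..})) \<le> enn2real (\<mu> (g -` {t<..}))" for t
  proof (rule enn2real_mono)
    have op: "open (f -` {t<..})" "open (g -` {t<..})"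
      using f g by (simp_all add: continuous_on_open_vimage)
    show "\<mu> (f -` {t<..}) \<le> \<mu> (g -` {t<..})"
      by (rule DTM_mono_open[OF \<mu> op]) (auto intro: less_le_trans le)
    show "\<mu> (g -` {t<..}) < top"
      using DTM_mono_open[OF \<mu> op(2) open_UNIV] \<mu> by (auto simp: DTM_def)
  qed
  then have "integral {a..b} (\<lambda>t. enn2real (\<mu> (f -` {t<..})))
      \<le> integral {a..b} (\<lambda>t. enn2real (\<mu> (g -` {t<..})))"
    by (intro integral_le level_integrable[OF \<mu> f] level_integrable[OF \<mu> g])
  then show ?thesis
    by (simp add: quasi_integral_eq[OF \<mu> f ranges(1)] quasi_integral_eq[OF \<mu> g ranges(2)]
        quasi_integral_over_def)
qed

text \<open>
  The set \<open>{x. c * f x + d > t}\<close> is the level set of \<open>f\<close> at height \<open>(t - d) / c\<close>, so this is an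
  affine substitution in the integral over the heights.
\<close>

lemma quasi_integral_affine:
  fixes f :: "'a::t2_space \<Rightarrow> real"
  assumes \<mu>: "\<mu> \<in> DTM" and f: "continuous_on UNIV f" and range: "range f \<subseteq> {a..b}" and c: "c > 0"
  shows "quasi_integral \<mu> (\<lambda>x. c * f x + d) = c * quasi_integral \<mu> f + d * enn2real (\<mu> UNIV)"
proof -
  let ?g = "\<lambda>t. enn2real (\<mu> (f -` {t<..}))"
  have cont: "continuous_on UNIV (\<lambda>x. c * f x + d)"
    using f by (intro continuous_intros)
  have range': "range (\<lambda>x. c * f x + d) \<subseteq> {c * a + d..c * b + d}"
    using range c by (auto simp: image_subset_iff)
  have level: "(\<lambda>x. c * f x + d) -` {t<..} = f -` {(1/c) * t + (- d / c)<..}" for t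
    using c by (auto simp: field_simps)
  have "(?g has_integral integral {a..b} ?g) (cbox a b)"
    using level_integrable[OF \<mu> f, of a b] by (simp add: has_integral_iff)
  from has_integral_affinity'[OF this, of "1/c" "- d / c"]
  have "((\<lambda>t. ?g ((1/c) * t + (- d / c))) has_integral c * integral {a..b} ?g)
      {(a - - d / c) /\<^sub>R (1/c)..(b - - d / c) /\<^sub>R (1/c)}"
    using c by simp
  moreover have "(r - - d / c) /\<^sub>R (1/c) = c * r + d" for r
    using c by (simp add: field_simps)
  ultimately have "((\<lambda>t. ?g ((1/c) * t + (- d / c))) has_integral c * integral {a..b} ?g)
      {c * a + d..c * b + d}"
    by simp
  then have "integral {c * a + d..c * b + d} (\<lambda>t. ?g ((1/c) * t + (- d / c)))
      = c * integral {a..b} ?g"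
    by (rule integral_unique)
  then show ?thesis
    unfolding quasi_integral_eq[OF \<mu> cont range'] quasi_integral_eq[OF \<mu> f range]
      quasi_integral_over_def level by (simp add: algebra_simps)
qed

lemma quasi_integral_uniform_lipschitz:
  fixes f g :: "'a::t2_space \<Rightarrow> real"
  assumes \<mu>: "\<mu> \<in> DTM" and f: "continuous_on UNIV f" and g: "continuous_on UNIV g"
    and ranges: "range f \<subseteq> {a..b}" "range g \<subseteq> {a..b}"
    and close: "\<And>x. \<bar>f x - g x\<bar> \<le> \<epsilon>"
  shows "\<bar>quasi_integral \<mu> f - quasi_integral \<mu> g\<bar> \<le> \<epsilon> * enn2real (\<mu> UNIV)"
proof -
  have \<epsilon>: "0 \<le> \<epsilon>" using close[of undefined] by linarith
  have one_sided: "quasi_integral \<mu> u \<le> quasi_integral \<mu> v + \<epsilon> * enn2real (\<mu> UNIV)"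
    if u: "continuous_on UNIV u" "range u \<subseteq> {a..b}" and v: "continuous_on UNIV v" "range v \<subseteq> {a..b}"
      and uv: "\<And>x. u x \<le> v x + \<epsilon>" for u v :: "'a \<Rightarrow> real"
  proof -
    have "quasi_integral \<mu> u \<le> quasi_integral \<mu> (\<lambda>x. 1 * v x + \<epsilon>)"
    proof (rule quasi_integral_mono[OF \<mu> u(1)])
      show "continuous_on UNIV (\<lambda>x. 1 * v x + \<epsilon>)" using v(1) by (intro continuous_intros)
      show "range u \<subseteq> {a..b + \<epsilon>}" "range (\<lambda>x. 1 * v x + \<epsilon>) \<subseteq> {a..b + \<epsilon>}"
        using u(2) v(2) \<epsilon> by (auto simp: image_subset_iff add_increasing2 add_mono)
    qed (use uv in auto)
    then show ?thesis using quasi_integral_affine[OF \<mu> v zero_less_one, of \<epsilon>] by simp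
  qed
  have "f x \<le> g x + \<epsilon>" "g x \<le> f x + \<epsilon>" for x using close[of x] by linarith+
  with one_sided[OF f ranges(1) g ranges(2)] one_sided[OF g ranges(2) f ranges(1)]
  show ?thesis by (simp add: abs_le_iff)
qed

section \<open>The total mass and the norm of the functional\<close>

lemma DTM_compact_le_open:
  assumes "\<mu> \<in> DTM" "compact C" "open U" "C \<subseteq> U"
  shows "\<mu> C \<le> \<mu> U"
proof -
  have "\<mu> U = (SUP C\<in>{C. compact C \<and> C \<subseteq> U}. \<mu> C)"
    using assms by (auto simp: DTM_def deficient_topological_measure_def inner_compact_regular_def)
  then show ?thesis using assms by (auto intro: SUP_upper)
qed

lemma Cc_I:
  fixes f :: "'a::t2_space \<Rightarrow> real"
  assumes "continuous_on UNIV f" "compact K" "\<And>x. x \<notin> K \<Longrightarrow> f x = 0"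
  shows "f \<in> Cc"
proof -
  have "closure {x. f x \<noteq> 0} \<subseteq> K"
    using assms compact_imp_closed[OF assms(2)] by (intro closure_minimal) auto
  then have "closure {x. f x \<noteq> 0} = K \<inter> closure {x. f x \<noteq> 0}" by blast
  then have "compact (closure {x. f x \<noteq> 0})"
    using compact_Int_closed[OF assms(2) closed_closure] by metis
  then show ?thesis using assms(1) by (simp add: Cc_def)
qed

lemma locally_compact_bump_function:
  fixes C :: "'a::metric_space set"
  assumes lc: "locally_compact_space (euclidean :: 'a topology)" and C: "compact C" "C \<noteq> {}"
  obtains f where "f \<in> Cc" "range f \<subseteq> {0..1}" "\<And>x. x \<in> C \<Longrightarrow> f x = 1"
proof -
  have "compactin (euclidean :: 'a topology) C" using C(1) by simp
  then have "\<exists>U L. openin euclidean U \<and> compactin euclidean L \<and> closedin euclidean L \<and> C \<subseteq> U \<and> U \<subseteq> L"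
    using locally_compact_space_compact_closed_compact[of "euclidean :: 'a topology"] lc
      Hausdorff_space_euclidean by metis
  then obtain U L where "openin euclidean U" "compactin euclidean L" and CUL: "C \<subseteq> U" "U \<subseteq> L"
    by blast
  then have UL: "open U" "compact L" by simp_all
  obtain \<delta> where \<delta>: "\<delta> > 0" "(\<Union>x\<in>C. ball x \<delta>) \<subseteq> U"
    using compact_subset_open_imp_ball_epsilon_subset[OF C(1) UL(1) CUL(1)] .
  define f where "f x = max 0 (1 - infdist x C / \<delta>)" for x
  have supp: "x \<in> L" if "f x \<noteq> 0" for x
  proof -
    have "infdist x C < \<delta>"
      using that \<delta>(1) by (auto simp: f_def max_def field_simps split: if_splits)
    then have "\<exists>c\<in>C. dist x c < \<delta>"
      using C(2) by (simp add: infdist_def cINF_less_iff)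
    then have "x \<in> (\<Union>x\<in>C. ball x \<delta>)" by (auto simp: dist_commute)
    then show ?thesis using \<delta>(2) CUL(2) by blast
  qed
  have "f \<in> Cc"
  proof (rule Cc_I[OF _ UL(2)])
    show "continuous_on UNIV f"
      unfolding f_def using \<delta>(1) by (intro continuous_intros) auto
  qed (use supp in blast)
  moreover have "range f \<subseteq> {0..1}" using \<delta>(1) by (auto simp: f_def infdist_nonneg)
  moreover have "f x = 1" if "x \<in> C" for x using that by (simp add: f_def)
  ultimately show ?thesis by (rule that)
qed

text \<open>
  A bump function equal to \<open>1\<close> on a compact \<open>C\<close> has all its level sets at heights in \<open>[0, 1)\<close>
  containing \<open>C\<close>, so its quasi-integral is at least \<open>\<mu> C\<close>; inner regularity does the rest.
\<close>

lemma DTM_UNIV_le_functional_norm: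
  fixes \<mu> :: "'a::metric_space set \<Rightarrow> ennreal"
  assumes lc: "locally_compact_space (euclidean :: 'a topology)" and \<mu>: "\<mu> \<in> DTM"
  shows "\<mu> UNIV \<le> ennreal (functional_norm (quasi_integral \<mu>))"
proof -
  have "\<mu> C \<le> ennreal (functional_norm (quasi_integral \<mu>))" if C: "compact C" for C
  proof (cases "C = {}")
    case True
    then show ?thesis by (simp add: DTM_empty[OF \<mu>])
  next
    case False
    obtain f where f: "f \<in> Cc" "range f \<subseteq> {0..1}" "\<And>x. x \<in> C \<Longrightarrow> f x = 1"
      using locally_compact_bump_function[OF lc C False] by blast
    then have cont: "continuous_on UNIV f" by (simp add: Cc_def)
    let ?m = "enn2real (\<mu> C)" and ?g = "\<lambda>t. enn2real (\<mu> (f -` {t<..}))"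
    have fin: "\<mu> A < top" if "open A" for A
      using DTM_mono_open[OF \<mu> that open_UNIV] \<mu> by (auto simp: DTM_def)
    have level: "?m \<le> ?g t" if "t < 1" for t
    proof (rule enn2real_mono)
      have op: "open (f -` {t<..})" using cont by (simp add: continuous_on_open_vimage)
      show "\<mu> C \<le> \<mu> (f -` {t<..})"
        using that f(3) by (intro DTM_compact_le_open[OF \<mu> C op]) auto
      show "\<mu> (f -` {t<..}) < top" by (rule fin[OF op])
    qed
    \<comment> \<open>At height \<open>1\<close> the level set is empty, so the constant lower bound is changed there.\<close>
    have "((\<lambda>t. if t = 1 then 0 else ?m) has_integral ?m) {0..1::real}"
    proof (rule has_integral_spike[of "{1}"])
      show "((\<lambda>t. ?m) has_integral ?m) {0..1::real}"
        using has_integral_const_real[of ?m 0 1] by simp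
    qed auto
    moreover have "(?g has_integral quasi_integral \<mu> f) {0..1}"
      using level_integrable[OF \<mu> cont, of 0 1]
      by (simp add: quasi_integral_eq[OF \<mu> cont f(2)] quasi_integral_over_def has_integral_iff)
    ultimately have "?m \<le> quasi_integral \<mu> f"
      by (rule has_integral_le) (auto intro: level)
    also have "\<dots> \<le> \<bar>quasi_integral \<mu> f\<bar>" by simp
    also have "\<dots> \<le> functional_norm (quasi_integral \<mu>)"
      unfolding functional_norm_def
    proof (rule cSUP_upper[OF _ bdd_above_functional_norm[OF \<mu>]])
      have "0 \<le> f x" "f x \<le> 1" for x using f(2) by (auto simp: image_subset_iff)
      then show "f \<in> {f \<in> Cc_plus. unorm f \<le> 1}"
        using f(1) by (auto simp: Cc_plus_def unorm_def intro!: cSUP_least)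
    qed
    finally have "ennreal ?m \<le> ennreal (functional_norm (quasi_integral \<mu>))"
      by (rule ennreal_leI)
    moreover have "\<mu> C < top"
      using DTM_compact_le_open[OF \<mu> C open_UNIV] fin[OF open_UNIV] by auto
    ultimately show ?thesis by simp
  qed
  moreover have "\<mu> UNIV = (SUP C\<in>{C. compact C \<and> C \<subseteq> UNIV}. \<mu> C)"
    using \<mu> by (auto simp: DTM_def deficient_topological_measure_def inner_compact_regular_def)
  ultimately show ?thesis by (simp add: SUP_le_iff)
qed

section \<open>Uniform approximation by Lipschitz functions of compact support\<close>

text \<open>
  Compactness gives one radius that works at all points of the support, with balls taken in the
  whole space; two points outside the support have the same value.
\<close>

lemma Cc_uniformly_continuous:
  fixes f :: "'a::metric_space \<Rightarrow> real"
  assumes f: "f \<in> Cc" and \<epsilon>: "\<epsilon> > 0"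
  obtains \<delta> where "\<delta> > 0" "\<And>x y. dist x y < \<delta> \<Longrightarrow> \<bar>f x - f y\<bar> < \<epsilon>"
proof -
  let ?K = "closure {x. f x \<noteq> 0}"
  let ?G = "\<lambda>z. f -` ball (f z) (\<epsilon>/2)"
  have K: "compact ?K" and cont: "continuous_on UNIV f" using f by (simp_all add: Cc_def)
  have out: "f x = 0" if "x \<notin> ?K" for x using that closure_subset[of "{x. f x \<noteq> 0}"] by auto
  have "x \<in> ?G x" for x using \<epsilon> by simp
  then have cover: "?K \<subseteq> \<Union>(range ?G)" by blast
  have op: "open G" if "G \<in> range ?G" for G
    using that cont by (auto simp: continuous_on_open_vimage)
  obtain \<delta> where \<delta>: "\<delta> > 0" "\<And>x. x \<in> ?K \<Longrightarrow> \<exists>G\<in>range ?G. ball x \<delta> \<subseteq> G"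
    using Heine_Borel_lemma[OF K cover op] by metis
  have near: "\<bar>f x - f y\<bar> < \<epsilon>" if "x \<in> ?K" "dist x y < \<delta>" for x y
  proof -
    obtain z where z: "ball x \<delta> \<subseteq> ?G z" using \<delta>(2)[OF \<open>x \<in> ?K\<close>] by blast
    have "x \<in> ball x \<delta>" "y \<in> ball x \<delta>" using that \<delta>(1) by auto
    then have "x \<in> ?G z" "y \<in> ?G z" using z by blast+
    then have "dist (f z) (f x) < \<epsilon>/2" "dist (f z) (f y) < \<epsilon>/2" by simp_all
    then show ?thesis unfolding dist_real_def abs_less_iff by (simp add: field_simps)
  qed
  have "\<bar>f x - f y\<bar> < \<epsilon>" if "dist x y < \<delta>" for x y
  proof (cases "x \<in> ?K \<or> y \<in> ?K")
    case True
    then show ?thesis using near[of x y] near[of y x] that by (auto simp: dist_commute abs_minus_commute)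
  next
    case False
    then have "f x = 0" "f y = 0" using out by blast+
    then show ?thesis using \<epsilon> by simp
  qed
  with \<delta>(1) show ?thesis by (rule that)
qed

text \<open>
  The inf-convolution of \<open>h\<close> with a steep cone: nonnegativity of \<open>h\<close> keeps it between \<open>0\<close> and \<open>h\<close>,
  and uniform continuity controls the loss from points close to \<open>x\<close>.
\<close>

lemma Cc_plus_approx_lipschitz:
  fixes h :: "'a::metric_space \<Rightarrow> real"
  assumes h: "h \<in> Cc_plus" and \<epsilon>: "\<epsilon> > 0"
  obtains g L where "g \<in> Cc_plus" "L-lipschitz_on UNIV g"
    "\<And>x. g x \<le> h x" "\<And>x. h x - \<epsilon> \<le> g x"
proof -
  have hCc: "h \<in> Cc" and pos: "\<And>x. 0 \<le> h x" using h by (auto simp: Cc_plus_def)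
  obtain \<delta> where \<delta>: "\<delta> > 0" "\<And>x y. dist x y < \<delta> \<Longrightarrow> \<bar>h x - h y\<bar> < \<epsilon>"
    using Cc_uniformly_continuous[OF hCc \<epsilon>] by blast
  \<comment> \<open>With this slope, points at distance at least \<open>\<delta>\<close> cannot lower the infimum below \<open>h x\<close>.\<close>
  define L where "L = unorm h / \<delta>"
  have bound: "h x \<le> unorm h" for x using abs_le_unorm_Cc[OF hCc, of x] by linarith
  have L: "0 \<le> L" using bound[of undefined] pos[of undefined] \<delta>(1) by (simp add: L_def)
  define g where "g x = (INF y. h y + L * dist x y)" for x
  have bdd: "bdd_below (range (\<lambda>y. h y + L * dist x y))" for x
    using pos L by (intro bdd_belowI2[of _ 0]) simp
  have upper: "g x \<le> h y + L * dist x y" for x y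
    unfolding g_def by (rule cINF_lower[OF bdd UNIV_I])
  have g_nonneg: "0 \<le> g x" for x
    unfolding g_def using pos L by (intro cINF_greatest) auto
  have g_le: "g x \<le> h x" for x using upper[of x x] by simp
  have g_ge: "h x - \<epsilon> \<le> g x" for x
    unfolding g_def
  proof (rule cINF_greatest)
    fix y
    show "h x - \<epsilon> \<le> h y + L * dist x y"
    proof (cases "dist x y < \<delta>")
      case True
      have "0 \<le> L * dist x y" using L by simp
      then show ?thesis using \<delta>(2)[OF True] by linarith
    next
      case False
      then have "L * \<delta> \<le> L * dist x y" using L by (intro mult_left_mono) auto
      moreover have "L * \<delta> = unorm h" using \<delta>(1) by (simp add: L_def)
      ultimately show ?thesis using bound[of x] pos[of y] \<epsilon> by linarith
    qed
  qed simp
  have g_diff: "g x - L * dist x y \<le> g y" for x y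
    unfolding g_def[of y]
  proof (rule cINF_greatest)
    fix z
    have "L * dist x z \<le> L * (dist x y + dist y z)"
      using L dist_triangle by (intro mult_left_mono)
    then show "g x - L * dist x y \<le> h z + L * dist y z"
      using upper[of x z] by (simp add: algebra_simps)
  qed simp
  have lip: "L-lipschitz_on UNIV g"
  proof (rule lipschitz_onI[OF _ L])
    fix x y show "dist (g x) (g y) \<le> L * dist x y"
      using g_diff[of x y] g_diff[of y x] by (simp add: dist_real_def dist_commute abs_le_iff)
  qed
  have "g \<in> Cc"
  proof (rule Cc_I)
    show "continuous_on UNIV g" using lip by (rule lipschitz_on_continuous_on)
    show "compact (closure {x. h x \<noteq> 0})" using hCc by (simp add: Cc_def)
    show "g x = 0" if "x \<notin> closure {x. h x \<noteq> 0}" for x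
    proof -
      have "h x = 0" using that closure_subset[of "{x. h x \<noteq> 0}"] by auto
      then show ?thesis using g_nonneg[of x] g_le[of x] by linarith
    qed
  qed
  then have "g \<in> Cc_plus" using g_nonneg by (simp add: Cc_plus_def)
  then show ?thesis using lip g_le g_ge by (rule that)
qed

lemma C0_plus_approx_lipschitz:
  fixes f :: "'a::metric_space \<Rightarrow> real"
  assumes f: "f \<in> C0_plus" and \<epsilon>: "\<epsilon> > 0"
  obtains g L where "g \<in> Cc_plus" "L-lipschitz_on UNIV g"
    "\<And>x. g x \<le> f x" "\<And>x. f x - \<epsilon> \<le> g x"
proof -
  have cont: "continuous_on UNIV f" and pos: "\<And>x. 0 \<le> f x" using f by (auto simp: C0_plus_def)
  have "\<epsilon>/2 > 0" using \<epsilon> by simp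
  then obtain K where K: "compact K" "\<And>x. x \<notin> K \<Longrightarrow> \<bar>f x\<bar> < \<epsilon>/2"
    using f unfolding C0_plus_def by blast
  define h where "h x = max 0 (f x - \<epsilon>/2)" for x
  have "h \<in> Cc"
  proof (rule Cc_I[OF _ K(1)])
    show "continuous_on UNIV h" unfolding h_def using cont by (intro continuous_intros)
    show "h x = 0" if "x \<notin> K" for x using K(2)[OF that] by (simp add: h_def)
  qed
  then have "h \<in> Cc_plus" by (simp add: Cc_plus_def h_def)
  then obtain g L where g: "g \<in> Cc_plus" "L-lipschitz_on UNIV g"
    "\<And>x. g x \<le> h x" "\<And>x. h x - \<epsilon>/2 \<le> g x"
    using Cc_plus_approx_lipschitz[OF _ \<open>\<epsilon>/2 > 0\<close>] by blast
  show ?thesis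
  proof (rule that[OF g(1,2)])
    show "g x \<le> f x" for x using g(3)[of x] pos[of x] \<epsilon> by (simp add: h_def)
    show "f x - \<epsilon> \<le> g x" for x using g(4)[of x] by (simp add: h_def)
  qed
qed

section \<open>Weak convergence from the Kantorovich-Rubinstein metric\<close>

text \<open>
  The constant comes from dividing \<open>g\<close> by something at least its Lipschitz constant and its norm;
  it depends on \<open>g\<close> alone and not on the two measures.
\<close>

lemma quasi_integral_diff_le_dKR:
  fixes g :: "'a::metric_space \<Rightarrow> real"
  assumes g: "g \<in> Cc" "L-lipschitz_on UNIV g"
  obtains N where "N > 0"
    "\<And>\<mu> \<nu>. \<mu> \<in> DTM \<Longrightarrow> \<nu> \<in> DTM \<Longrightarrow>
      \<bar>quasi_integral \<mu> g - quasi_integral \<nu> g\<bar> \<le> N * dKR \<mu> \<nu>"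
proof -
  define N where "N = max 1 (max L (unorm g))"
  have N: "N > 0" "L \<le> N" "unorm g \<le> N" by (auto simp: N_def)
  have cont: "continuous_on UNIV g" and K: "compact (closure {x. g x \<noteq> 0})"
    using g(1) by (simp_all add: Cc_def)
  have bound: "\<bar>g x\<bar> \<le> unorm g" for x by (rule abs_le_unorm_Cc[OF g(1)])
  have range: "range g \<subseteq> {- unorm g..unorm g}"
    using bound by (auto simp: abs_le_iff minus_le_iff)
  define u where "u x = 1/N * g x + 0" for x
  have "u \<in> Cc"
  proof (rule Cc_I[OF _ K])
    show "continuous_on UNIV u" unfolding u_def using cont by (intro continuous_intros)
    show "u x = 0" if "x \<notin> closure {x. g x \<noteq> 0}" for x
      using that closure_subset[of "{x. g x \<noteq> 0}"] by (auto simp: u_def)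
  qed
  moreover have "1-lipschitz_on UNIV u"
  proof (rule lipschitz_onI)
    fix x y
    have "dist (g x) (g y) \<le> L * dist x y" using lipschitz_onD[OF g(2)] by simp
    also have "\<dots> \<le> N * dist x y" using N by (intro mult_right_mono) auto
    finally have "dist (g x) (g y) / N \<le> dist x y" using N(1) by (simp add: field_simps)
    moreover have "dist (u x) (u y) = dist (g x) (g y) / N"
      using N(1) by (simp add: u_def dist_real_def flip: diff_divide_distrib)
    ultimately show "dist (u x) (u y) \<le> 1 * dist x y" by simp
  qed simp
  moreover have "unorm u \<le> 1"
    unfolding unorm_def
  proof (rule cSUP_least)
    show "\<bar>u x\<bar> \<le> 1" for x using bound[of x] N by (simp add: u_def)
  qed simp
  ultimately have u: "u \<in> {f \<in> Cc. 1-lipschitz_on UNIV f \<and> unorm f \<le> 1}" by simp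
  show ?thesis
  proof (rule that[OF N(1)])
    fix \<mu> \<nu> :: "'a set \<Rightarrow> ennreal" assume \<mu>: "\<mu> \<in> DTM" and \<nu>: "\<nu> \<in> DTM"
    have hom: "quasi_integral \<rho> u = quasi_integral \<rho> g / N" if "\<rho> \<in> DTM" for \<rho>
      using quasi_integral_affine[OF that cont range, of "1/N" 0] N(1)
      by (simp add: u_def[abs_def])
    have "\<bar>quasi_integral \<mu> u - quasi_integral \<nu> u\<bar> \<le> dKR \<mu> \<nu>"
      unfolding dKR_def by (rule cSUP_upper[OF u bdd_above_dKR[OF \<mu> \<nu>]])
    then show "\<bar>quasi_integral \<mu> g - quasi_integral \<nu> g\<bar> \<le> N * dKR \<mu> \<nu>"
      using N(1) by (simp add: hom \<mu> \<nu> field_simps flip: diff_divide_distrib)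
  qed
qed

lemma dKR_tendsto_imp_converges_weakly:
  fixes \<mu> :: "'a::metric_space set \<Rightarrow> ennreal"
  assumes \<mu>s: "\<forall>\<^sub>F i in F. \<mu>s i \<in> DTM \<and> enn2real (\<mu>s i UNIV) \<le> c"
    and \<mu>: "\<mu> \<in> DTM" "enn2real (\<mu> UNIV) \<le> c"
    and lim: "((\<lambda>i. dKR (\<mu>s i) \<mu>) \<longlongrightarrow> 0) F"
  shows "converges_weakly \<mu>s \<mu> F"
  unfolding converges_weakly_def
proof (intro ballI tendstoI)
  fix f :: "'a \<Rightarrow> real" and e :: real
  assume f: "f \<in> C0_plus" and e: "e > 0"
  have c: "0 \<le> c" using \<mu>(2) enn2real_nonneg order_trans by blast
  \<comment> \<open>Replacing \<open>f\<close> by \<open>g\<close> then costs at most \<open>e/4\<close> for each of the two measures.\<close>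
  define \<epsilon> where "\<epsilon> = e / (4 * (c + 1))"
  have \<epsilon>: "\<epsilon> > 0" using e c by (simp add: \<epsilon>_def)
  have \<epsilon>c: "\<epsilon> * c \<le> e/4" using e c by (simp add: \<epsilon>_def field_simps)
  obtain g L where g: "g \<in> Cc_plus" "L-lipschitz_on UNIV g"
    and gf: "\<And>x. g x \<le> f x" "\<And>x. f x - \<epsilon> \<le> g x"
    using C0_plus_approx_lipschitz[OF f \<epsilon>] by blast
  have gCc: "g \<in> Cc" "\<And>x. 0 \<le> g x" using g(1) by (auto simp: Cc_plus_def)
  have cont: "continuous_on UNIV f" "continuous_on UNIV g"
    using f gCc by (auto simp: C0_plus_def Cc_def)
  have "f x \<in> {0..unorm g + \<epsilon>} \<and> g x \<in> {0..unorm g + \<epsilon>}" for x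
  proof -
    have "g x \<le> unorm g" using abs_le_unorm_Cc[OF gCc(1), of x] by linarith
    then show ?thesis
      using gf(1)[of x] gf(2)[of x] gCc(2)[of x] \<epsilon> unfolding atLeastAtMost_iff by linarith
  qed
  then have ranges: "range f \<subseteq> {0..unorm g + \<epsilon>}" "range g \<subseteq> {0..unorm g + \<epsilon>}" by blast+
  have approx: "\<bar>quasi_integral \<nu> f - quasi_integral \<nu> g\<bar> \<le> e/4"
    if "\<nu> \<in> DTM" "enn2real (\<nu> UNIV) \<le> c" for \<nu>
  proof -
    have "\<bar>f x - g x\<bar> \<le> \<epsilon>" for x using gf[of x] by linarith
    then have "\<bar>quasi_integral \<nu> f - quasi_integral \<nu> g\<bar> \<le> \<epsilon> * enn2real (\<nu> UNIV)"
      by (rule quasi_integral_uniform_lipschitz[OF that(1) cont ranges])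
    also have "\<dots> \<le> \<epsilon> * c" using that(2) \<epsilon> by (intro mult_left_mono) auto
    finally show ?thesis using \<epsilon>c by linarith
  qed
  obtain N where N: "N > 0" "\<And>\<mu> \<nu>. \<mu> \<in> DTM \<Longrightarrow> \<nu> \<in> DTM \<Longrightarrow>
      \<bar>quasi_integral \<mu> g - quasi_integral \<nu> g\<bar> \<le> N * dKR \<mu> \<nu>"
    using quasi_integral_diff_le_dKR[OF gCc(1) g(2)] by blast
  have "\<forall>\<^sub>F i in F. dKR (\<mu>s i) \<mu> < e / (2 * N)"
    using order_tendstoD(2)[OF lim] e N(1) by simp
  with \<mu>s show "\<forall>\<^sub>F i in F. dist (quasi_integral (\<mu>s i) f) (quasi_integral \<mu> f) < e"
  proof eventually_elim
    case (elim i)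
    have "N * dKR (\<mu>s i) \<mu> < e/2" using elim(2) N(1) by (simp add: field_simps)
    moreover have "\<bar>quasi_integral (\<mu>s i) g - quasi_integral \<mu> g\<bar> \<le> N * dKR (\<mu>s i) \<mu>"
      using N(2) elim(1) \<mu>(1) by blast
    moreover have "\<bar>quasi_integral (\<mu>s i) f - quasi_integral (\<mu>s i) g\<bar> \<le> e/4"
      using approx elim(1) by blast
    moreover have "\<bar>quasi_integral \<mu> f - quasi_integral \<mu> g\<bar> \<le> e/4"
      by (rule approx[OF \<mu>])
    ultimately show ?case
      unfolding dist_real_def abs_le_iff abs_less_iff by (simp add: field_simps)
  qed
qed

theorem theorem41:
  fixes \<M> :: "('a::metric_space set \<Rightarrow> ennreal) set"
    and \<mu>s :: "'i \<Rightarrow> 'a set \<Rightarrow> ennreal"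
    and \<mu> :: "'a set \<Rightarrow> ennreal"
    and F :: "'i filter"
  assumes "locally_compact_space (euclidean :: 'a topology)"
    and "(\<M> \<subseteq> TM \<and> uniformly_bounded_variation \<M>) \<or>
         (\<exists>M::real. M > 0 \<and> \<M> = {\<nu> \<in> DTM. functional_norm (quasi_integral \<nu>) \<le> M})"
    and "\<forall>\<^sub>F i in F. \<mu>s i \<in> \<M>"
    and "\<mu> \<in> \<M>"
    and "((\<lambda>i. dKR (\<mu>s i) \<mu>) \<longlongrightarrow> 0) F"
  shows "converges_weakly \<mu>s \<mu> F"
proof -
  have "\<exists>c. \<forall>\<nu>\<in>\<M>. \<nu> \<in> DTM \<and> enn2real (\<nu> UNIV) \<le> c"
    using assms(2)
  proof (elim disjE conjE exE)
    assume "\<M> \<subseteq> TM" "uniformly_bounded_variation \<M>"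
    then obtain c :: real where "c > 0" "\<And>\<nu>. \<nu> \<in> \<M> \<Longrightarrow> \<nu> UNIV \<le> ennreal c"
      by (auto simp: uniformly_bounded_variation_def)
    then have "enn2real (\<nu> UNIV) \<le> c" if "\<nu> \<in> \<M>" for \<nu>
      using that by (intro enn2real_leI) auto
    then show ?thesis using \<open>\<M> \<subseteq> TM\<close> TM_subset_DTM by blast
  next
    fix M :: real
    assume M: "M > 0" "\<M> = {\<nu> \<in> DTM. functional_norm (quasi_integral \<nu>) \<le> M}"
    have "\<nu> \<in> DTM \<and> enn2real (\<nu> UNIV) \<le> M" if "\<nu> \<in> \<M>" for \<nu>
    proof
      show \<nu>: "\<nu> \<in> DTM" using that M(2) by simp
      have "\<nu> UNIV \<le> ennreal (functional_norm (quasi_integral \<nu>))"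
        by (rule DTM_UNIV_le_functional_norm[OF assms(1) \<nu>])
      also have "\<dots> \<le> ennreal M" using that M(2) by (intro ennreal_leI) simp
      finally show "enn2real (\<nu> UNIV) \<le> M" using M(1) by (intro enn2real_leI) auto
    qed
    then show ?thesis by blast
  qed
  then obtain c where c: "\<And>\<nu>. \<nu> \<in> \<M> \<Longrightarrow> \<nu> \<in> DTM \<and> enn2real (\<nu> UNIV) \<le> c" by blast
  have "\<forall>\<^sub>F i in F. \<mu>s i \<in> DTM \<and> enn2real (\<mu>s i UNIV) \<le> c"
    using assms(3) by (rule eventually_mono) (rule c)
  then show ?thesis
    using c[OF assms(4)] assms(5) by (intro dKR_tendsto_imp_converges_weakly) auto
qed

end
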